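(* There exists an absolute constant $c>0$ such that for every $p\in[1,\infty]$, every integer $n\geq 1$, all real numbers $W\geq 1$ and $\lambda\geq 1$, and every integer $j\in[-n,n]$, $$\mathbb{P}_{p,W,n}\left(\operatorname{diam} C_{\pi}(j)\geq \lambda\right)\leq 2\exp\left(-c\,\frac{\lambda}{W^3}\right).$$ Here $c$ does not depend on $p,\lambda,n,W$ or $j$.
   Context: For an integer $n\geq 1$, $[-n,n]$ denotes the set of integers $\{-n,-n+1,\dots,n\}$. For real $W\geq 1$ and $p\in[1,\infty)$, $\mathbb{P}_{p,W,n}$ is the probability measure on permutations (bijections) $\pi:[-n,n]\to[-n,n]$ given by $$\mathbb{P}_{p,W,n}(\pi)\propto \exp\left(-\frac{1}{W^p}\sum_{i\in[-n,n]}|\pi(i)-i|^p\right).$$ For $p=\infty$, $\mathbb{P}_{\infty,W,n}$ is the uniform probability measure on the set of permutations $\pi$ of $[-n,n]$ satisfying $\max_{i\in[-n,n]}|\pi(i)-i|\leq W$. The random permutation $\pi$ is sampled from $\mathbb{P}_{p,W,n}$. The cycle of $j$ in $\pi$ is the set $C_{\pi}(j):=\{\pi^k(j):k\in\mathbb{Z}\}\subseteq[-n,n]$, and $\operatorname{diam} C_\pi(j)=\max C_\pi(j)-\min C_\pi(j)$. *)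

theory Defs
  imports "HOL-Probability.Probability"
begin

definition sym_box :: "nat \<Rightarrow> int set" where
  "sym_box n = {- int n..int n}"

text \<open>Bijections of \<open>sym_box n\<close> are represented by functions on \<open>int\<close> that
  are the identity outside \<open>sym_box n\<close>, so each bijection is represented exactly once.\<close>

definition box_perms :: "nat \<Rightarrow> (int \<Rightarrow> int) set" where
  "box_perms n = {\<pi>. \<pi> permutes sym_box n}"

definition weight :: "real \<Rightarrow> real \<Rightarrow> nat \<Rightarrow> (int \<Rightarrow> int) \<Rightarrow> real" where
  "weight p W n \<pi> =
     exp (- (1 / W powr p) * (\<Sum>i\<in>sym_box n. (real_of_int \<bar>\<pi> i - i\<bar>) powr p))"

definition partition_fun :: "real \<Rightarrow> real \<Rightarrow> nat \<Rightarrow> real" where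
  "partition_fun p W n = (\<Sum>\<pi>\<in>box_perms n. weight p W n \<pi>)"

definition band_perms :: "real \<Rightarrow> nat \<Rightarrow> (int \<Rightarrow> int) set" where
  "band_perms W n =
     {\<pi> \<in> box_perms n. real_of_int (Max ((\<lambda>i. \<bar>\<pi> i - i\<bar>) ` sym_box n)) \<le> W}"

definition perm_pmf :: "ereal \<Rightarrow> real \<Rightarrow> nat \<Rightarrow> (int \<Rightarrow> int) pmf" where
  "perm_pmf p W n =
     (if p = \<infinity> then pmf_of_set (band_perms W n)
      else embed_pmf (\<lambda>\<pi>. if \<pi> \<in> box_perms n
             then weight (real_of_ereal p) W n \<pi> / partition_fun (real_of_ereal p) W n
             else 0))"

definition perm_zpow :: "(int \<Rightarrow> int) \<Rightarrow> int \<Rightarrow> (int \<Rightarrow> int)" where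
  "perm_zpow \<pi> k = (if 0 \<le> k then \<pi> ^^ nat k else inv \<pi> ^^ nat (- k))"

definition perm_cycle :: "(int \<Rightarrow> int) \<Rightarrow> int \<Rightarrow> int set" where
  "perm_cycle \<pi> j = {perm_zpow \<pi> k j |k. True}"

definition cycle_diam :: "(int \<Rightarrow> int) \<Rightarrow> int \<Rightarrow> int" where
  "cycle_diam \<pi> j = Max (perm_cycle \<pi> j) - Min (perm_cycle \<pi> j)"

text \<open>The following facts show that the arguments of \<open>embed_pmf\<close>, \<open>pmf_of_set\<close>,
  \<open>Max\<close> and \<open>Min\<close> above are legitimate.\<close>

lemma finite_sym_box [simp]: "finite (sym_box n)"
  by (simp add: sym_box_def)

lemma finite_box_perms [simp]: "finite (box_perms n)"
  by (simp add: box_perms_def finite_permutations)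

lemma id_in_box_perms: "id \<in> box_perms n"
  by (simp add: box_perms_def permutes_id)

lemma partition_fun_pos: "0 < partition_fun p W n"
  unfolding partition_fun_def
  using id_in_box_perms by (intro sum_pos) (auto simp: weight_def)

lemma pmf_perm_pmf_finite:
  assumes "p \<noteq> \<infinity>"
  shows "pmf (perm_pmf p W n) \<pi> =
    (if \<pi> \<in> box_perms n
     then weight (real_of_ereal p) W n \<pi> / partition_fun (real_of_ereal p) W n else 0)"
proof -
  let ?r = "real_of_ereal p"
  let ?f = "\<lambda>\<pi>. if \<pi> \<in> box_perms n then weight ?r W n \<pi> / partition_fun ?r W n else 0"
  have nn: "0 \<le> ?f x" for x
    using partition_fun_pos[of ?r W n] by (simp add: weight_def)
  have "(\<integral>\<^sup>+x. ennreal (?f x) \<partial>count_space UNIV) = (\<Sum>x\<in>box_perms n. ennreal (?f x))"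
    by (rule nn_integral_count_space'[OF finite_box_perms]) auto
  also have "\<dots> = ennreal (\<Sum>x\<in>box_perms n. ?f x)"
    using nn by (intro sum_ennreal) blast
  also have "(\<Sum>x\<in>box_perms n. ?f x) = (\<Sum>x\<in>box_perms n. weight ?r W n x) / partition_fun ?r W n"
    by (simp add: sum_divide_distrib)
  also have "\<dots> = 1"
    using partition_fun_pos[of ?r W n] by (simp add: partition_fun_def)
  finally have "(\<integral>\<^sup>+x. ennreal (?f x) \<partial>count_space UNIV) = 1" by simp
  from pmf_embed_pmf[of ?f, OF nn this] show ?thesis
    using assms by (simp add: perm_pmf_def)
qed

lemma finite_band_perms [simp]: "finite (band_perms W n)"
  by (simp add: band_perms_def)

lemma band_perms_nonempty:
  assumes "0 \<le> W"
  shows "band_perms W n \<noteq> {}"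
proof -
  have "sym_box n \<noteq> {}" by (simp add: sym_box_def)
  hence "(\<lambda>i. \<bar>id i - i\<bar>) ` sym_box n = {0}" by auto
  with assms have "id \<in> band_perms W n"
    unfolding band_perms_def using id_in_box_perms by simp
  thus ?thesis by blast
qed

lemma perm_cycle_finite_nonempty:
  assumes "\<pi> \<in> box_perms n" and "j \<in> sym_box n"
  shows "finite (perm_cycle \<pi> j)" and "perm_cycle \<pi> j \<noteq> {}"
proof -
  have *: "(f ^^ k) j \<in> sym_box n" if "f permutes sym_box n" for f k
    using that assms(2) by (induction k) (auto simp: permutes_in_image)
  have "\<pi> permutes sym_box n" using assms(1) by (simp add: box_perms_def)
  hence "perm_cycle \<pi> j \<subseteq> sym_box n"
    using permutes_inv * by (auto simp: perm_cycle_def perm_zpow_def)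
  thus "finite (perm_cycle \<pi> j)" using finite_sym_box finite_subset by blast
  show "perm_cycle \<pi> j \<noteq> {}" by (auto simp: perm_cycle_def)
qed

end

theory Submission
  imports Defs "HOL-Combinatorics.Cycles"
begin

text \<open>
  Let \<open>M\<close> be the maximum of the cycle of \<open>j\<close>. If \<open>j \<le> k < M\<close>, then following the cycle from
  \<open>j\<close> in both directions up to its first exit from \<open>(-\<infinity>, k]\<close> gives an edge \<open>i \<mapsto> \<pi> i\<close> leaving and
  an edge \<open>u \<mapsto> \<pi> u\<close> entering this half-line. Exchanging the two targets closes the path to a
  cycle inside \<open>(-\<infinity>, k]\<close>. Uncrossing two edges never increases the cost, and it saves a factor
  exponential in (distance of the ends to \<open>k\<close>) \<open>/ W\<close>, uniformly in \<open>p\<close>; as the new permutation and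
  \<open>(i, u)\<close> determine \<open>\<pi>\<close>, the preimages of a permutation have total relative weight \<open>O(W\<^sup>2)\<close>, and the new
  maximum is within \<open>O(W)\<close> of \<open>k\<close>. So \<open>M\<close> stops in each window of length \<open>W\<close> with conditional
  probability at least of order \<open>W\<^sup>-\<^sup>2\<close>. In exponential moments: with \<open>\<theta> = c / W\<^sup>3\<close>,
  \<open>\<Sum>\<^sub>k e\<^bsup>\<theta>(k - j)\<^esup> P(M > k) \<le> C W\<^sup>3 E e\<^bsup>\<theta>(M - j)\<^esup>\<close>, and since the left side determines
  \<open>E e\<^bsup>\<theta>(M - j)\<^esup>\<close> by Abel summation, a small \<open>c\<close> yields \<open>E e\<^bsup>\<theta>(M - j)\<^esup> \<le> 2\<close>. Reflection treats the
  minimum, and \<open>xy \<le> (x\<^sup>2 + y\<^sup>2) / 2\<close> combines both into the same bound for the diameter.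
\<close>

abbreviation swap :: "int \<Rightarrow> int \<Rightarrow> int \<Rightarrow> int" where
  "swap \<equiv> Transposition.transpose"

section \<open>Inequalities for powers and geometric sums\<close>

lemma powr_superadditive:
  fixes a b p :: real
  assumes "0 \<le> a" "0 \<le> b" "1 \<le> p"
  shows "a powr p + b powr p \<le> (a + b) powr p"
proof -
  have *: "c powr p = c * c powr (p - 1)" if "0 \<le> c" for c :: real
    using that powr_add[of c 1 "p - 1"] by simp
  have "a powr p + b powr p = a * a powr (p - 1) + b * b powr (p - 1)"
    using * assms by simp
  also have "\<dots> \<le> a * (a + b) powr (p - 1) + b * (a + b) powr (p - 1)"
    using assms by (intro add_mono mult_left_mono powr_mono2) auto
  also have "\<dots> = (a + b) powr p"
    using *[of "a + b"] assms by (simp add: algebra_simps)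
  finally show ?thesis .
qed

text \<open>Here \<open>x\<close>, \<open>x'\<close> stand for the distances to the cut of the ends
  \<open>i\<close>, \<open>\<pi> u\<close> below it, and \<open>y\<close>, \<open>y'\<close> for
  those of \<open>u\<close>, \<open>\<pi> i\<close> above it. The crossing edges have lengths
  \<open>x + y'\<close> and \<open>x' + y\<close>, the uncrossed ones
  \<open>\<bar>x - x'\<bar>\<close> and \<open>\<bar>y - y'\<bar>\<close>.\<close>

lemma powr_uncrossing:
  fixes x x' y y' p :: real
  assumes "0 \<le> x" "0 \<le> x'" "0 \<le> y" "0 \<le> y'" "1 \<le> p"
  shows "\<bar>x - x'\<bar> powr p + \<bar>y - y'\<bar> powr p + (min x x') powr p + (min y y') powr p
    \<le> (x + y') powr p + (x' + y) powr p"
proof -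
  define d where "d = min x x' + min y y'"
  have d: "0 \<le> d" "min x x' \<le> d" "min y y' \<le> d" "0 \<le> min x x'" "0 \<le> min y y'"
    using assms by (auto simp: d_def)
  have md: "(min x x') powr p \<le> d powr p" "(min y y') powr p \<le> d powr p"
    using d assms by (auto intro!: powr_mono2)
  note sup = powr_superadditive[OF _ _ assms(5)]
  \<comment> \<open>If the two pairs are ordered alike, each crossing edge is longer by
    \<open>d\<close> than one uncrossed edge. Otherwise one crossing edge has length
    \<open>d\<close> and the other is the sum of both uncrossed lengths and \<open>d\<close>.
    Superadditivity yields \<open>d powr p\<close> twice in either case.\<close>
  show ?thesis
  proof (cases "(x \<le> x') = (y \<le> y')")
    case True
    have "\<bar>x - x'\<bar> powr p + d powr p \<le> (\<bar>x - x'\<bar> + d) powr p"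
         "\<bar>y - y'\<bar> powr p + d powr p \<le> (\<bar>y - y'\<bar> + d) powr p"
      using d by (auto intro!: sup)
    moreover have
      "(x + y') powr p + (x' + y) powr p = (\<bar>x - x'\<bar> + d) powr p + (\<bar>y - y'\<bar> + d) powr p"
      using True by (auto simp: d_def min_def abs_if algebra_simps)
    ultimately show ?thesis using md by linarith
  next
    case False
    have "\<bar>x - x'\<bar> powr p + \<bar>y - y'\<bar> powr p \<le> (\<bar>x - x'\<bar> + \<bar>y - y'\<bar>) powr p"
         "(\<bar>x - x'\<bar> + \<bar>y - y'\<bar>) powr p + d powr p \<le> (\<bar>x - x'\<bar> + \<bar>y - y'\<bar> + d) powr p"
      using d by (auto intro!: sup)
    moreover have
      "(x + y') powr p + (x' + y) powr p = (\<bar>x - x'\<bar> + \<bar>y - y'\<bar> + d) powr p + d powr p"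
      using False by (auto simp: d_def min_def abs_if algebra_simps)
    ultimately show ?thesis using md by linarith
  qed
qed

lemma powr_ge_diff_one:
  fixes t p :: real
  assumes "0 \<le> t" "1 \<le> p"
  shows "t - 1 \<le> t powr p"
proof (cases "t \<le> 1")
  case True
  then show ?thesis using powr_ge_zero[of t p] by linarith
next
  case False
  then have "t powr 1 \<le> t powr p" using assms by (intro powr_mono) auto
  then show ?thesis using False by simp
qed

text \<open>Injectivity of \<open>f\<close> bounds the sum by the full geometric series of ratio
  \<open>exp (- 1 / s)\<close>, and \<open>exp (1 / s) \<ge> 1 + 1 / s\<close> bounds its
  value.\<close>

lemma sum_powers_le:
  fixes s :: real
  assumes "1 \<le> s" "finite A" "inj_on f A" "\<And>a. a \<in> A \<Longrightarrow> real (f a) = g a"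
  shows "(\<Sum>a\<in>A. exp (- g a / s)) \<le> 1 + s"
proof -
  define q where "q = exp (- 1 / s)"
  have q: "0 < q" "q < 1" using assms(1) by (auto simp: q_def)
  have "(\<Sum>a\<in>A. exp (- g a / s)) = (\<Sum>a\<in>A. q ^ f a)"
    using assms(4) by (intro sum.cong) (auto simp: q_def exp_of_nat_mult[symmetric])
  also have "\<dots> = (\<Sum>m\<in>f ` A. q ^ m)"
    using assms(3) by (simp add: sum.reindex)
  also have "\<dots> \<le> (\<Sum>m. q ^ m)"
    using q assms(2) by (intro sum_le_suminf summable_geometric) auto
  also have "\<dots> = 1 / (1 - q)"
    using q by (intro suminf_geometric) auto
  also have "\<dots> \<le> 1 + s"
  proof -
    have "1 + 1 / s \<le> exp (1 / s)" by (rule exp_ge_add_one_self)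
    then have "q \<le> 1 / (1 + 1 / s)"
      using assms(1) by (simp add: q_def exp_minus field_simps)
    also have "\<dots> = s / (1 + s)" using assms(1) by (simp add: field_simps)
    finally have "1 \<le> (1 + s) * (1 - q)" using assms(1) by (simp add: field_simps)
    then show ?thesis using q by (simp add: field_simps)
  qed
  finally show ?thesis .
qed

lemma sum_exp_abs_le:
  fixes s :: real and k :: int
  assumes "1 \<le> s" "finite A"
  shows "(\<Sum>i\<in>A. exp (- real_of_int \<bar>i - k\<bar> / s)) \<le> (1 + s) + (1 + s)"
proof -
  let ?g = "\<lambda>i. exp (- real_of_int \<bar>i - k\<bar> / s)"
  have "sum ?g A = sum ?g {i\<in>A. i \<le> k} + sum ?g {i\<in>A. \<not> i \<le> k}"
    using assms(2) by (subst sum.union_disjoint[symmetric]) (auto intro: sum.cong)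
  also have "\<dots> \<le> (1 + s) + (1 + s)"
  proof (rule add_mono)
    show "sum ?g {i\<in>A. i \<le> k} \<le> 1 + s"
      using assms by (intro sum_powers_le[where f = "\<lambda>i. nat (k - i)"]) (auto simp: inj_on_def)
    show "sum ?g {i\<in>A. \<not> i \<le> k} \<le> 1 + s"
      using assms by (intro sum_powers_le[where f = "\<lambda>i. nat (i - k)"]) (auto simp: inj_on_def)
  qed
  finally show ?thesis .
qed

section \<open>Cycles and their closing below a cut\<close>

lemma funpow_return:
  fixes f :: "'a \<Rightarrow> 'a"
  assumes "f permutes S" "finite S"
  obtains N where "N > 0" "f ^^ N = id"
  using permutation_is_nilpotent[of f] assms that unfolding permutation_permutes by blast

text \<open>A permutation of a finite set has finite order, so its inverse is one of its nonnegative
  powers and the forward orbit is the whole cycle.\<close>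

lemma perm_cycle_eq:
  assumes "\<pi> \<in> box_perms n"
  shows "perm_cycle \<pi> j = range (\<lambda>k. (\<pi> ^^ k) j)"
proof -
  have perm: "\<pi> permutes sym_box n" using assms by (simp add: box_perms_def)
  then obtain N where N: "N > 0" "\<pi> ^^ N = id"
    using funpow_return finite_sym_box by metis
  have "inv \<pi> = \<pi> ^^ (N - 1)"
  proof (rule inv_unique_comp)
    show "\<pi> \<circ> \<pi> ^^ (N - 1) = id"
      using N by (metis Suc_diff_1 funpow.simps(2))
    show "\<pi> ^^ (N - 1) \<circ> \<pi> = id"
      using N by (metis Suc_diff_1 funpow_Suc_right)
  qed
  then have inv_pow: "(inv \<pi> ^^ k) = \<pi> ^^ ((N - 1) * k)" for k
    by (simp add: funpow_mult)
  have "perm_zpow \<pi> k j \<in> range (\<lambda>k. (\<pi> ^^ k) j)" for k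
    by (simp add: perm_zpow_def inv_pow)
  moreover have "(\<pi> ^^ k) j = perm_zpow \<pi> (int k) j" for k
    by (simp add: perm_zpow_def)
  ultimately show ?thesis
    unfolding perm_cycle_def by blast
qed

definition cycle_top :: "(int \<Rightarrow> int) \<Rightarrow> int \<Rightarrow> int" where
  "cycle_top \<pi> j = Max (perm_cycle \<pi> j)"

text \<open>The bounds of \<open>i\<close> and \<open>\<pi> u\<close> by the new top place both
  lower ends at distance at least \<open>k\<close> minus that top from the cut. This ties the saving
  in cost to the position of the top.\<close>

lemma cycle_closing:
  assumes "\<pi> \<in> box_perms n" "j \<in> sym_box n" "j \<le> k" "k < cycle_top \<pi> j"
  obtains i u where "i \<in> sym_box n" "u \<in> sym_box n" "i \<le> k" "k < u" "k < \<pi> i" "\<pi> u \<le> k"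
    "\<pi> \<circ> swap i u \<in> box_perms n"
    "i \<le> cycle_top (\<pi> \<circ> swap i u) j" "\<pi> u \<le> cycle_top (\<pi> \<circ> swap i u) j"
    "cycle_top (\<pi> \<circ> swap i u) j \<le> k"
proof -
  define s where "s t = (\<pi> ^^ t) j" for t
  have s_Suc: "s (Suc t) = \<pi> (s t)" for t by (simp add: s_def)
  have perm: "\<pi> permutes sym_box n" using assms(1) by (simp add: box_perms_def)
  have s_in: "s t \<in> sym_box n" for t
    by (induction t) (use assms(2) perm in \<open>auto simp: s_def permutes_in_image\<close>)
  obtain N where N: "N > 0" "\<pi> ^^ N = id"
    using funpow_return[OF perm finite_sym_box] by metis
  have s0: "s 0 = j" and sN: "s N = j" using N by (auto simp: s_def)
  have s_mod: "s t = s (t mod N)" for t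
    using N(2) by (simp add: s_def funpow_mod_eq)
  have "cycle_top \<pi> j \<in> perm_cycle \<pi> j"
    unfolding cycle_top_def using perm_cycle_finite_nonempty[OF assms(1,2)] by (rule Max_in)
  then obtain t0 where t0: "k < s t0"
    using assms(4) by (auto simp: perm_cycle_eq[OF assms(1)] s_def)
  define T where "T = {t. t < N \<and> k < s t}"
  have T: "finite T" "T \<noteq> {}"
    using t0 N(1) s_mod[of t0] by (auto simp: T_def intro!: exI[of _ "t0 mod N"])
  \<comment> \<open>The first exit and, walking on until the return to \<open>j\<close>, the last re-entrance; this avoids
    following \<open>inv \<pi>\<close>.\<close>
  define a where "a = Min T"
  define b where "b = Max T"
  have a: "a < N" "k < s a" and b: "b < N" "k < s b"
    using Min_in[OF T] Max_in[OF T] by (auto simp: T_def a_def b_def)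
  have a_min: "s t \<le> k" if "t < a" for t
    using that Min_le[OF T(1), of t] a(1) by (fastforce simp: T_def a_def)
  have b_max: "s t \<le> k" if "b < t" "t \<le> N" for t
    using that Max_ge[OF T(1), of t] sN assms(3) by (cases "t = N") (fastforce simp: T_def b_def)+
  have "a \<noteq> 0" using a(2) s0 assms(3) by (metis not_le)
  then obtain a' where a': "a = Suc a'" by (cases a) auto
  define i u where "i = s a'" and "u = s b"
  define \<sigma> where "\<sigma> = \<pi> \<circ> swap i u"
  have i: "i \<in> sym_box n" "i \<le> k" "k < \<pi> i"
    using a(2) a_min[of a'] s_in by (auto simp: i_def a' s_Suc)
  have u: "u \<in> sym_box n" "k < u" "\<pi> u \<le> k"
    using b b_max[of "Suc b"] s_in by (auto simp: u_def s_Suc)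
  have \<sigma>: "\<sigma> \<in> box_perms n"
    using perm i u by (auto simp: \<sigma>_def box_perms_def intro!: permutes_compose permutes_swap_id)
  have \<sigma>_i: "\<sigma> i = \<pi> u" by (simp add: \<sigma>_def)
  have \<sigma>_other: "\<sigma> x = \<pi> x" if "x \<noteq> i" "x \<le> k" for x
    using that u by (auto simp: \<sigma>_def Transposition.transpose_def)
  \<comment> \<open>An earlier visit to \<open>i\<close> would leave the half-line one step later,
    before the first exit time \<open>a\<close>.\<close>
  have s_ne: "s t \<noteq> i" if "t < a'" for t
  proof
    assume "s t = i"
    then have "s (Suc t) = s a" by (simp add: s_Suc i_def a')
    then show False using a_min[of "Suc t"] that a(2) a' by auto
  qed
  have \<sigma>_pow: "(\<sigma> ^^ t) j = s t" if "t \<le> a'" for t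
    using that
  proof (induction t)
    case (Suc t)
    then show ?case using \<sigma>_other[of "s t"] s_ne[of t] a_min[of t] a' by (simp add: s_Suc)
  qed (simp add: s0)
  \<comment> \<open>The walk from \<open>j\<close> to \<open>i\<close>, then the walk from the
    re-entrance \<open>s (Suc b)\<close> back to \<open>j\<close>. Closure of \<open>P\<close> under
    \<open>\<sigma>\<close> confines the new cycle to the half-line.\<close>
  define P where "P = s ` {..a'} \<union> s ` {b<..N}"
  have P_le: "x \<le> k" if "x \<in> P" for x
    using that a_min b_max a' by (auto simp: P_def)
  have j_in: "j \<in> P" using s0 by (force simp: P_def)
  have step: "\<sigma> x \<in> P" if "x \<in> P" for x
  proof (cases "x = i")
    case True
    then have "\<sigma> x = s (Suc b)" using \<sigma>_i by (simp add: u_def s_Suc)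
    then show ?thesis using b(1) by (auto simp: P_def)
  next
    case False
    then have eq: "\<sigma> x = \<pi> x" using \<sigma>_other P_le that by auto
    \<comment> \<open>Index \<open>N\<close> is traded for \<open>0\<close>, as both give
      \<open>j\<close>; then \<open>Suc t\<close> stays within the ranges defining
      \<open>P\<close>.\<close>
    from that obtain t where t: "x = s t" "t \<le> a' \<or> (b < t \<and> t < N)"
      using s0 sN by (fastforce simp: P_def le_less)
    then have "\<sigma> x = s (Suc t)" "t \<noteq> a'" using eq False by (auto simp: s_Suc i_def)
    then show ?thesis using t by (auto simp: P_def)
  qed
  have "(\<sigma> ^^ t) j \<in> P" for t
    by (induction t) (use j_in step in auto)
  then have cyc: "perm_cycle \<sigma> j \<subseteq> P" by (auto simp: perm_cycle_eq[OF \<sigma>])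
  note fin = perm_cycle_finite_nonempty[OF \<sigma> assms(2)]
  have "cycle_top \<sigma> j \<le> k"
    unfolding cycle_top_def using cyc P_le fin by (subst Max_le_iff) auto
  moreover have "(\<sigma> ^^ a') j = i" "(\<sigma> ^^ Suc a') j = \<pi> u"
    using \<sigma>_pow[of a'] \<sigma>_i by (auto simp: i_def)
  then have "i \<in> perm_cycle \<sigma> j" "\<pi> u \<in> perm_cycle \<sigma> j"
    by (metis perm_cycle_eq[OF \<sigma>] rangeI)+
  then have "i \<le> cycle_top \<sigma> j" "\<pi> u \<le> cycle_top \<sigma> j"
    unfolding cycle_top_def using fin by auto
  ultimately show ?thesis
    using that i u \<sigma> unfolding \<sigma>_def by blast
qed

section \<open>Weighted counting of the cycles that cross a cut\<close>

text \<open>The common property of the Gibbs weights for finite \<open>p\<close> and of the indicator for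
  \<open>p = \<infinity>\<close>. The factor \<open>exp 2\<close> absorbs the difference between \<open>(t / W)\<^sup>p\<close> and \<open>t / W\<close> at
  distances \<open>t \<le> W\<close>, once for each side of the cut.\<close>

definition uncrossing_weight :: "real \<Rightarrow> nat \<Rightarrow> ((int \<Rightarrow> int) \<Rightarrow> real) \<Rightarrow> bool" where
  "uncrossing_weight W n w \<longleftrightarrow> (\<forall>\<pi>. 0 \<le> w \<pi>) \<and>
     (\<forall>\<pi>\<in>box_perms n. \<forall>i\<in>sym_box n. \<forall>u\<in>sym_box n. \<forall>k.
        i \<le> k \<longrightarrow> k < u \<longrightarrow> k < \<pi> i \<longrightarrow> \<pi> u \<le> k \<longrightarrow>
        w \<pi> \<le> exp 2 * exp (- real_of_int (min \<bar>i - k\<bar> \<bar>\<pi> u - k\<bar>) / W)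
              * exp (- real_of_int (min \<bar>u - k\<bar> \<bar>\<pi> i - k\<bar>) / W) * w (\<pi> \<circ> swap i u))"

text \<open>Half of the exponential saving is kept to sum over the ends; the other half, in
  \<open>sum_weight_above_le\<close> below, confines the top of the new cycle to within order \<open>W\<close> of \<open>k\<close>.\<close>

definition port :: "real \<Rightarrow> int \<Rightarrow> (int \<Rightarrow> int) \<Rightarrow> int \<Rightarrow> real" where
  "port W k \<sigma> i = exp (- real_of_int (min \<bar>i - k\<bar> \<bar>\<sigma> i - k\<bar>) / (2 * W))"

text \<open>The minimum is split into a term for the source and one for the target. The targets run
  through the box once each, so both give the same two-sided geometric sum.\<close>

lemma sum_port_le:
  assumes "1 \<le> W" "\<sigma> \<in> box_perms n"
  shows "(\<Sum>i\<in>sym_box n. port W k \<sigma> i) \<le> 12 * W"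
proof -
  have perm: "\<sigma> permutes sym_box n" using assms by (simp add: box_perms_def)
  let ?g = "\<lambda>i. exp (- real_of_int \<bar>i - k\<bar> / (2 * W))"
  have "(\<Sum>i\<in>sym_box n. port W k \<sigma> i) \<le> (\<Sum>i\<in>sym_box n. ?g i + ?g (\<sigma> i))"
    by (intro sum_mono) (auto simp: port_def min_def)
  also have "\<dots> = sum ?g (sym_box n) + sum ?g (sym_box n)"
    using sum.reindex_bij_betw[OF permutes_imp_bij[OF perm], of ?g] by (simp only: sum.distrib)
  also have "\<dots> \<le> ((1 + 2 * W) + (1 + 2 * W)) + ((1 + 2 * W) + (1 + 2 * W))"
    using assms by (intro add_mono sum_exp_abs_le) auto
  also have "\<dots> \<le> 12 * W" using assms by simp
  finally show ?thesis .
qed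

text \<open>A choice of codes is injective because \<open>g\<close> decodes it, so no code in
  \<open>T\<close> is charged twice.\<close>

lemma sum_le_sum_decode:
  fixes f :: "'a \<Rightarrow> real" and G :: "'b \<Rightarrow> real"
  assumes "finite T" "\<And>y. y \<in> T \<Longrightarrow> 0 \<le> G y"
    and ex: "\<And>x. x \<in> D \<Longrightarrow> \<exists>y\<in>T. g y = x \<and> f x \<le> G y"
  shows "sum f D \<le> sum G T"
proof -
  obtain h where h: "\<And>x. x \<in> D \<Longrightarrow> h x \<in> T \<and> g (h x) = x \<and> f x \<le> G (h x)"
    using ex by metis
  then have inj: "inj_on h D" by (metis inj_onI)
  have "sum f D \<le> (\<Sum>x\<in>D. G (h x))" using h by (intro sum_mono) auto
  also have "\<dots> = sum G (h ` D)" using inj by (simp add: sum.reindex)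
  also have "\<dots> \<le> sum G T" using h assms by (intro sum_mono2) auto
  finally show ?thesis .
qed

text \<open>The code of \<open>\<pi>\<close> is \<open>(\<sigma>, i, u)\<close> with
  \<open>\<sigma> = \<pi> \<circ> swap i u\<close>, decoded by the same transposition. For fixed
  \<open>\<sigma>\<close> the sum over \<open>(i, u)\<close> factors into two \<open>port\<close>
  sums, whence the factor \<open>W\<^sup>2\<close>.\<close>

lemma sum_weight_above_le:
  assumes W: "1 \<le> W" and w: "uncrossing_weight W n w" and j: "j \<in> sym_box n" "j \<le> k"
  shows "(\<Sum>\<pi>\<in>{\<pi>\<in>box_perms n. k < cycle_top \<pi> j}. w \<pi>)
    \<le> (\<Sum>\<sigma>\<in>{\<sigma>\<in>box_perms n. cycle_top \<sigma> j \<le> k}.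
          1152 * W\<^sup>2 * exp (- real_of_int (k - cycle_top \<sigma> j) / (2 * W)) * w \<sigma>)"
proof -
  let ?D = "{\<pi>\<in>box_perms n. k < cycle_top \<pi> j}"
  let ?R = "{\<sigma>\<in>box_perms n. cycle_top \<sigma> j \<le> k}"
  let ?S = "sym_box n"
  define e where "e \<sigma> = exp (- real_of_int (k - cycle_top \<sigma> j) / (2 * W))" for \<sigma>
  define G where "G = (\<lambda>(\<sigma>, i, u). exp 2 * e \<sigma> * w \<sigma> * (port W k \<sigma> i * port W k \<sigma> u))"
  have w0: "0 \<le> w \<pi>" for \<pi> using w by (simp add: uncrossing_weight_def)
  have encode: "\<exists>z\<in>?R \<times> ?S \<times> ?S. (\<lambda>(\<sigma>, i, u). \<sigma> \<circ> swap i u) z = \<pi> \<and> w \<pi> \<le> G z"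
    if "\<pi> \<in> ?D" for \<pi>
  proof -
    have D: "\<pi> \<in> box_perms n" "k < cycle_top \<pi> j" using that by auto
    obtain i u where *: "i \<in> ?S" "u \<in> ?S" "i \<le> k" "k < u" "k < \<pi> i" "\<pi> u \<le> k"
      "\<pi> \<circ> swap i u \<in> box_perms n"
      "i \<le> cycle_top (\<pi> \<circ> swap i u) j" "\<pi> u \<le> cycle_top (\<pi> \<circ> swap i u) j"
      "cycle_top (\<pi> \<circ> swap i u) j \<le> k"
      by (rule cycle_closing[OF D(1) j D(2)])
    define \<sigma> where "\<sigma> = \<pi> \<circ> swap i u"
    define m where "m = min \<bar>i - k\<bar> \<bar>\<pi> u - k\<bar>"
    define l where "l = min \<bar>u - k\<bar> \<bar>\<pi> i - k\<bar>"
    have eqs: "\<sigma> i = \<pi> u" "\<sigma> u = \<pi> i" by (auto simp: \<sigma>_def)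
    have m: "real_of_int (k - cycle_top \<sigma> j) \<le> real_of_int m" and l: "0 \<le> real_of_int l"
      using * unfolding of_int_le_iff m_def l_def \<sigma>_def by auto
    have "w \<pi> \<le> exp 2 * exp (- real_of_int m / W) * exp (- real_of_int l / W) * w \<sigma>"
      using w * that unfolding uncrossing_weight_def m_def l_def \<sigma>_def by blast
    \<comment> \<open>The factor in \<open>m\<close> is split into halves: one becomes
      \<open>e \<sigma>\<close>, since \<open>k - cycle_top \<sigma> j \<le> m\<close>, the other
      the port of \<open>i\<close>. The factor in \<open>l\<close> is only weakened.\<close>
    also have "\<dots> \<le> exp 2 * (e \<sigma> * port W k \<sigma> i) * port W k \<sigma> u * w \<sigma>"
    proof (intro mult_right_mono mult_mono mult_left_mono w0)
      have "- real_of_int m / W \<le> - real_of_int (k - cycle_top \<sigma> j) / (2 * W) - real_of_int m / (2 * W)"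
      proof -
        have "real_of_int (k - cycle_top \<sigma> j) / (2 * W) \<le> real_of_int m / (2 * W)"
          using m W by (intro divide_right_mono) auto
        moreover have "real_of_int m / W = real_of_int m / (2 * W) + real_of_int m / (2 * W)"
          by simp
        ultimately show ?thesis by (simp only: minus_divide_left[symmetric])
      qed
      then show "exp (- real_of_int m / W) \<le> e \<sigma> * port W k \<sigma> i"
        unfolding e_def port_def eqs m_def[symmetric] exp_add[symmetric] by simp
      show "exp (- real_of_int l / W) \<le> port W k \<sigma> u"
        using l W unfolding port_def eqs l_def[symmetric] by (simp add: field_simps)
    qed (auto simp: e_def port_def)
    also have "\<dots> = G (\<sigma>, i, u)" by (simp add: G_def)
    finally have "w \<pi> \<le> G (\<sigma>, i, u)" .
    moreover have "\<sigma> \<circ> swap i u = \<pi>" by (simp add: \<sigma>_def o_assoc[symmetric])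
    moreover have "(\<sigma>, i, u) \<in> ?R \<times> ?S \<times> ?S" using * by (simp add: \<sigma>_def)
    ultimately show ?thesis by (intro bexI[of _ "(\<sigma>, i, u)"]) auto
  qed
  have e0: "0 \<le> e \<sigma>" for \<sigma> by (simp add: e_def)
  have G0: "0 \<le> G z" for z
    using w0 e0 by (cases z) (simp add: G_def port_def)
  have "sum w ?D \<le> sum G (?R \<times> ?S \<times> ?S)"
    using encode G0 by (intro sum_le_sum_decode[where g = "\<lambda>(\<sigma>, i, u). \<sigma> \<circ> swap i u"]) auto
  also have "\<dots> = (\<Sum>\<sigma>\<in>?R. \<Sum>i\<in>?S. \<Sum>u\<in>?S. G (\<sigma>, i, u))"
    by (simp add: sum.cartesian_product)
  also have "\<dots> = (\<Sum>\<sigma>\<in>?R. exp 2 * e \<sigma> * w \<sigma> * (sum (port W k \<sigma>) ?S * sum (port W k \<sigma>) ?S))"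
    unfolding G_def prod.case sum_product by (simp only: sum_distrib_left)
  \<comment> \<open>\<open>exp 2 \<le> 8\<close> and each \<open>port\<close> sum is at most
    \<open>12 * W\<close>; \<open>1152 = 8 * 12 * 12\<close>.\<close>
  also have "\<dots> \<le> (\<Sum>\<sigma>\<in>?R. 8 * e \<sigma> * w \<sigma> * ((12 * W) * (12 * W)))"
  proof (intro sum_mono mult_mono sum_port_le W)
    have "exp 1 \<le> (272 / 100 :: real)" using abs_le_D1[OF e_approx_32] by (simp add: field_simps)
    then have "exp 1 * exp 1 \<le> (272 / 100 :: real) * (272 / 100)" by (intro mult_mono) auto
    then show "exp 2 \<le> (8::real)" by (simp add: exp_add[symmetric])
  qed (use w0 e0 W in \<open>auto simp: port_def intro: sum_nonneg\<close>)
  also have "\<dots> = (\<Sum>\<sigma>\<in>?R. 1152 * W\<^sup>2 * e \<sigma> * w \<sigma>)"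
    by (intro sum.cong) (auto simp: power2_eq_square)
  finally show ?thesis by (simp add: e_def)
qed

section \<open>The exponential moment of the top of a cycle\<close>

lemma exp_telescope:
  fixes t :: real and j M :: int
  assumes "j \<le> M"
  shows "exp (t * real_of_int (M - j)) = 1 + (exp t - 1) * (\<Sum>k\<in>{j..<M}. exp (t * real_of_int (k - j)))"
  using assms
proof (induction M rule: int_ge_induct)
  case (step M)
  have "{j..<M + 1} = insert M {j..<M}" using step by auto
  moreover have "exp (t * real_of_int (M + 1 - j)) = exp t * exp (t * real_of_int (M - j))"
    by (simp add: exp_add[symmetric] algebra_simps)
  moreover have "exp t * X = 1 + (exp t - 1) * (X + S)" if "X = 1 + (exp t - 1) * S" for X S
    unfolding that by (simp add: algebra_simps)
  ultimately show ?case using step by simp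
qed simp

text \<open>\<open>23040 = 4 * 5760\<close>, where \<open>5760 * W ^ 3\<close> is the factor in the bound for \<open>T\<close> below and
  \<open>exp t - 1 \<le> 2 * t\<close>, so that \<open>(exp t - 1) * T\<close> is at most half of the exponential moment.\<close>

definition decay :: "real \<Rightarrow> real" where
  "decay W = 1 / (23040 * W ^ 3)"

lemma cycle_top_ge:
  assumes "\<pi> \<in> box_perms n" "j \<in> sym_box n"
  shows "j \<le> cycle_top \<pi> j"
proof -
  have "j \<in> perm_cycle \<pi> j" by (auto simp: perm_cycle_eq[OF assms(1)] intro!: image_eqI[of _ _ 0])
  then show ?thesis
    unfolding cycle_top_def using perm_cycle_finite_nonempty[OF assms] by auto
qed

lemma cycle_top_le:
  assumes "\<pi> \<in> box_perms n" "j \<in> sym_box n"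
  shows "cycle_top \<pi> j \<le> int n"
proof -
  have "\<pi> permutes sym_box n" using assms by (simp add: box_perms_def)
  then have "(\<pi> ^^ k) j \<in> sym_box n" for k
    by (induction k) (use assms(2) in \<open>auto simp: permutes_in_image\<close>)
  then have "perm_cycle \<pi> j \<subseteq> sym_box n" by (auto simp: perm_cycle_eq[OF assms(1)])
  then show ?thesis
    unfolding cycle_top_def using perm_cycle_finite_nonempty[OF assms]
    by (subst Max_le_iff) (auto simp: sym_box_def)
qed

text \<open>Abel summation expresses \<open>E\<close> through the tail sum \<open>T\<close>, which
  is in turn bounded by a multiple of \<open>E\<close>. All sums are finite, so half of
  \<open>E\<close> can be absorbed.\<close>

lemma exponential_moment_top:
  assumes W: "1 \<le> W" and w: "uncrossing_weight W n w" and j: "j \<in> sym_box n"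
  shows "(\<Sum>\<pi>\<in>box_perms n. w \<pi> * exp (decay W * real_of_int (cycle_top \<pi> j - j)))
    \<le> 2 * sum w (box_perms n)"
proof -
  let ?B = "box_perms n"
  define t where "t = decay W"
  define M where "M \<pi> = cycle_top \<pi> j" for \<pi>
  define E where "E = (\<Sum>\<pi>\<in>?B. w \<pi> * exp (t * real_of_int (M \<pi> - j)))"
  have w0: "0 \<le> w \<pi>" for \<pi> using w by (simp add: uncrossing_weight_def)
  have E0: "0 \<le> E" unfolding E_def using w0 by (intro sum_nonneg) auto
  have M: "j \<le> M \<pi>" "M \<pi> \<le> int n" if "\<pi> \<in> ?B" for \<pi>
    using that j by (auto simp: M_def cycle_top_ge cycle_top_le)
  have W3: "W \<le> W ^ 3" using power_increasing[of 1 3 W] W by simp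
  have t0: "0 < t" using W by (simp add: t_def decay_def)
  \<comment> \<open>The growth at rate \<open>t\<close> uses up at most half of the decay at rate
    \<open>1 / (2 * W)\<close>.\<close>
  have tW: "t \<le> 1 / (4 * W)"
    unfolding t_def decay_def using W W3 by (intro divide_left_mono) auto
  have t1: "t \<le> 1" using tW W by (auto intro: order_trans)
  define T where "T = (\<Sum>\<pi>\<in>?B. w \<pi> * (\<Sum>k\<in>{j..<M \<pi>}. exp (t * real_of_int (k - j))))"
  have "E = (\<Sum>\<pi>\<in>?B. w \<pi> + (exp t - 1) * (w \<pi> * (\<Sum>k\<in>{j..<M \<pi>}. exp (t * real_of_int (k - j)))))"
    unfolding E_def by (intro sum.cong refl, subst exp_telescope) (use M in \<open>auto simp: algebra_simps\<close>)
  also have "\<dots> = sum w ?B + (exp t - 1) * T"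
    unfolding T_def by (simp add: sum.distrib sum_distrib_left)
  finally have E_eq: "E = sum w ?B + (exp t - 1) * T" .
  have "T = (\<Sum>\<pi>\<in>?B. \<Sum>k\<in>{k\<in>{j..int n}. k < M \<pi>}. w \<pi> * exp (t * real_of_int (k - j)))"
    unfolding T_def sum_distrib_left
    by (intro sum.cong refl) (use M in force)
  also have "\<dots> = (\<Sum>k\<in>{j..int n}. \<Sum>\<pi>\<in>{\<pi>\<in>?B. k < M \<pi>}. w \<pi> * exp (t * real_of_int (k - j)))"
    by (rule sum.swap_restrict) auto
  also have "\<dots> = (\<Sum>k\<in>{j..int n}. exp (t * real_of_int (k - j)) * (\<Sum>\<pi>\<in>{\<pi>\<in>?B. k < M \<pi>}. w \<pi>))"
    by (simp add: sum_distrib_left mult.commute)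
  also have "\<dots> \<le> (\<Sum>k\<in>{j..int n}. exp (t * real_of_int (k - j)) *
      (\<Sum>\<sigma>\<in>{\<sigma>\<in>?B. M \<sigma> \<le> k}. 1152 * W\<^sup>2 * exp (- real_of_int (k - M \<sigma>) / (2 * W)) * w \<sigma>))"
    using sum_weight_above_le[OF W w j] unfolding M_def
    by (intro sum_mono mult_left_mono) auto
  \<comment> \<open>Now \<open>\<sigma>\<close> is fixed and the cuts \<open>k\<close> above its top
    are summed; this geometric sum costs the third factor of \<open>W\<close>.\<close>
  also have "\<dots> = (\<Sum>\<sigma>\<in>?B. \<Sum>k\<in>{k\<in>{j..int n}. M \<sigma> \<le> k}. exp (t * real_of_int (k - j)) *
      (1152 * W\<^sup>2 * exp (- real_of_int (k - M \<sigma>) / (2 * W)) * w \<sigma>))"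
    unfolding sum_distrib_left by (rule sum.swap_restrict[symmetric]) auto
  also have "\<dots> \<le> (\<Sum>\<sigma>\<in>?B. 5760 * W ^ 3 * (w \<sigma> * exp (t * real_of_int (M \<sigma> - j))))"
  proof (rule sum_mono)
    fix \<sigma> assume \<sigma>: "\<sigma> \<in> ?B"
    let ?K = "{k\<in>{j..int n}. M \<sigma> \<le> k}"
    let ?c = "1152 * W\<^sup>2 * w \<sigma> * exp (t * real_of_int (M \<sigma> - j))"
    have c0: "0 \<le> ?c" using w0 by simp
    have K: "finite ?K" by (rule finite_subset[of _ "{j..int n}"]) auto
    have "(\<Sum>k\<in>?K. exp (t * real_of_int (k - j)) *
        (1152 * W\<^sup>2 * exp (- real_of_int (k - M \<sigma>) / (2 * W)) * w \<sigma>))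
      \<le> (\<Sum>k\<in>?K. ?c * exp (- real_of_int (k - M \<sigma>) / (4 * W)))"
    proof (rule sum_mono)
      fix k assume k: "k \<in> ?K"
      have *: "t * real_of_int (k - M \<sigma>) \<le> real_of_int (k - M \<sigma>) / (4 * W)"
        using mult_right_mono[OF tW, of "real_of_int (k - M \<sigma>)"] k by simp
      have "t * real_of_int (k - j) + - real_of_int (k - M \<sigma>) / (2 * W)
        \<le> t * real_of_int (M \<sigma> - j) + - real_of_int (k - M \<sigma>) / (4 * W)"
      proof -
        define q where "q = real_of_int (k - M \<sigma>)"
        have "q / (2 * W) = q / (4 * W) + q / (4 * W)" by simp
        moreover have "t * real_of_int (k - j) = t * real_of_int (M \<sigma> - j) + t * q"
          by (simp add: q_def algebra_simps)
        moreover have "t * q \<le> q / (4 * W)" using * by (simp only: q_def)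
        ultimately show ?thesis unfolding q_def[symmetric] by (simp only: minus_divide_left[symmetric])
      qed
      then have "exp (t * real_of_int (k - j)) * exp (- real_of_int (k - M \<sigma>) / (2 * W))
        \<le> exp (t * real_of_int (M \<sigma> - j)) * exp (- real_of_int (k - M \<sigma>) / (4 * W))"
        unfolding exp_add[symmetric] by simp
      from mult_left_mono[OF this, of "1152 * W\<^sup>2 * w \<sigma>"] w0[of \<sigma>]
      show "exp (t * real_of_int (k - j)) *
        (1152 * W\<^sup>2 * exp (- real_of_int (k - M \<sigma>) / (2 * W)) * w \<sigma>)
        \<le> ?c * exp (- real_of_int (k - M \<sigma>) / (4 * W))"
        by (simp add: mult_ac)
    qed
    also have "\<dots> = ?c * (\<Sum>k\<in>?K. exp (- real_of_int (k - M \<sigma>) / (4 * W)))"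
      by (simp add: sum_distrib_left)
    \<comment> \<open>The remaining rate \<open>1 / (4 * W)\<close> gives
      \<open>1 + 4 * W \<le> 5 * W\<close>, and \<open>5760 = 5 * 1152\<close>.\<close>
    also have "\<dots> \<le> ?c * (5 * W)"
    proof (rule mult_left_mono[OF _ c0])
      have "(\<Sum>k\<in>?K. exp (- real_of_int (k - M \<sigma>) / (4 * W))) \<le> 1 + 4 * W"
        using W K by (intro sum_powers_le[where f = "\<lambda>k. nat (k - M \<sigma>)"]) (auto simp: inj_on_def)
      then show "(\<Sum>k\<in>?K. exp (- real_of_int (k - M \<sigma>) / (4 * W))) \<le> 5 * W"
        using W by linarith
    qed
    also have "\<dots> = 5760 * W ^ 3 * (w \<sigma> * exp (t * real_of_int (M \<sigma> - j)))"
      by (simp add: power2_eq_square power3_eq_cube)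
    finally show "(\<Sum>k\<in>?K. exp (t * real_of_int (k - j)) *
        (1152 * W\<^sup>2 * exp (- real_of_int (k - M \<sigma>) / (2 * W)) * w \<sigma>))
      \<le> 5760 * W ^ 3 * (w \<sigma> * exp (t * real_of_int (M \<sigma> - j)))" .
  qed
  also have "\<dots> = 5760 * W ^ 3 * E" by (simp add: E_def sum_distrib_left)
  finally have T: "T \<le> 5760 * W ^ 3 * E" .
  have "exp t \<le> 1 + t + t\<^sup>2" using t0 t1 by (intro exp_bound) auto
  moreover have "t\<^sup>2 \<le> t" using t0 t1 by (simp add: power2_eq_square mult_left_le)
  ultimately have et: "0 \<le> exp t - 1" "exp t - 1 \<le> 2 * t" using t0 by auto
  have "(exp t - 1) * T \<le> (exp t - 1) * (5760 * W ^ 3 * E)"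
    using T et by (intro mult_left_mono)
  also have "\<dots> \<le> 2 * t * (5760 * W ^ 3 * E)"
    using et E0 W by (intro mult_right_mono) auto
  also have "\<dots> = E / 2" using W by (simp add: t_def decay_def field_simps)
  finally have "E \<le> 2 * sum w ?B" using E_eq by linarith
  then show ?thesis by (simp add: E_def t_def M_def)
qed

section \<open>Reflection and the diameter\<close>

text \<open>Conjugation by the sign change, which exchanges top and bottom of a cycle.\<close>

definition reflect :: "(int \<Rightarrow> int) \<Rightarrow> (int \<Rightarrow> int)" where
  "reflect \<pi> i = - \<pi> (- i)"

lemma reflect_reflect [simp]: "reflect (reflect \<pi>) = \<pi>"
  by (simp add: reflect_def fun_eq_iff)

lemma reflect_box_perms:
  assumes "\<pi> \<in> box_perms n"
  shows "reflect \<pi> \<in> box_perms n"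
proof -
  have perm: "\<pi> permutes sym_box n" using assms by (simp add: box_perms_def)
  have "\<And>x. x \<notin> sym_box n \<Longrightarrow> reflect \<pi> x = x"
    using permutes_not_in[OF perm] by (auto simp: reflect_def sym_box_def)
  moreover have "bij (reflect \<pi>)"
  proof (rule o_bij)
    show "reflect (inv \<pi>) \<circ> reflect \<pi> = id" "reflect \<pi> \<circ> reflect (inv \<pi>) = id"
      using permutes_inverses[OF perm] by (auto simp: reflect_def)
  qed
  ultimately show ?thesis by (simp add: box_perms_def permutes_def bij_iff)
qed

lemma reflect_bij: "bij_betw reflect (box_perms n) (box_perms n)"
  by (rule bij_betwI[where g = reflect]) (auto intro: reflect_box_perms)

lemma cycle_top_reflect:
  assumes "\<pi> \<in> box_perms n" "j \<in> sym_box n"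
  shows "cycle_top (reflect \<pi>) (- j) = - Min (perm_cycle \<pi> j)"
proof -
  have "(reflect \<pi> ^^ k) (- j) = - (\<pi> ^^ k) j" for k
    by (induction k) (auto simp: reflect_def)
  then have "perm_cycle (reflect \<pi>) (- j) = uminus ` perm_cycle \<pi> j"
    using assms by (auto simp: perm_cycle_eq[OF reflect_box_perms[OF assms(1)]] perm_cycle_eq)
  then show ?thesis
    using perm_cycle_finite_nonempty[OF assms] by (simp add: cycle_top_def minus_Min_eq_Max)
qed

lemma exponential_moment_diam:
  assumes W: "1 \<le> W" and w: "uncrossing_weight W n w" and j: "j \<in> sym_box n"
    and refl: "\<And>\<pi>. \<pi> \<in> box_perms n \<Longrightarrow> w (reflect \<pi>) = w \<pi>"
  shows "(\<Sum>\<pi>\<in>box_perms n. w \<pi> * exp (decay W / 2 * real_of_int (cycle_diam \<pi> j)))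
    \<le> 2 * sum w (box_perms n)"
proof -
  let ?B = "box_perms n"
  have w0: "0 \<le> w \<pi>" for \<pi> using w by (simp add: uncrossing_weight_def)
  have j': "- j \<in> sym_box n" using j by (auto simp: sym_box_def)
  let ?a = "\<lambda>\<pi>. exp (decay W * real_of_int (cycle_top \<pi> j - j))"
  let ?b = "\<lambda>\<pi>. exp (decay W * real_of_int (cycle_top \<pi> (- j) - (- j)))"
  have "w \<pi> * exp (decay W / 2 * real_of_int (cycle_diam \<pi> j))
      \<le> (w \<pi> * ?a \<pi> + w (reflect \<pi>) * ?b (reflect \<pi>)) / 2" if "\<pi> \<in> ?B" for \<pi>
  proof -
    \<comment> \<open>The rate is halved so that the squares of \<open>x\<close> and
      \<open>y\<close> carry the full rate \<open>decay W\<close>.\<close>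
    define x where "x = exp (decay W / 2 * real_of_int (cycle_top \<pi> j - j))"
    define y where "y = exp (decay W / 2 * real_of_int (j - Min (perm_cycle \<pi> j)))"
    have "exp (decay W / 2 * real_of_int (cycle_diam \<pi> j)) = x * y"
      by (simp add: x_def y_def exp_add[symmetric] cycle_diam_def cycle_top_def algebra_simps)
    moreover have "?a \<pi> = x\<^sup>2" "?b (reflect \<pi>) = y\<^sup>2"
      using cycle_top_reflect[OF that j]
      by (auto simp: x_def y_def power2_eq_square exp_add[symmetric] algebra_simps)
    moreover have "x * y \<le> (x\<^sup>2 + y\<^sup>2) / 2" using sum_squares_bound[of x y] by simp
    ultimately show ?thesis
      using mult_left_mono[OF _ w0, of "x * y" "(x\<^sup>2 + y\<^sup>2) / 2" \<pi>] refl[OF that]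
      by (simp add: algebra_simps)
  qed
  then have "(\<Sum>\<pi>\<in>?B. w \<pi> * exp (decay W / 2 * real_of_int (cycle_diam \<pi> j)))
    \<le> (\<Sum>\<pi>\<in>?B. (w \<pi> * ?a \<pi> + w (reflect \<pi>) * ?b (reflect \<pi>)) / 2)"
    by (rule sum_mono)
  also have "\<dots> = ((\<Sum>\<pi>\<in>?B. w \<pi> * ?a \<pi>) + (\<Sum>\<pi>\<in>?B. w (reflect \<pi>) * ?b (reflect \<pi>))) / 2"
    by (simp only: sum_divide_distrib[symmetric] sum.distrib)
  also have "(\<Sum>\<pi>\<in>?B. w (reflect \<pi>) * ?b (reflect \<pi>)) = (\<Sum>\<pi>\<in>?B. w \<pi> * ?b \<pi>)"
    by (rule sum.reindex_bij_betw[OF reflect_bij])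
  also have "((\<Sum>\<pi>\<in>?B. w \<pi> * ?a \<pi>) + (\<Sum>\<pi>\<in>?B. w \<pi> * ?b \<pi>)) / 2
    \<le> (2 * sum w ?B + 2 * sum w ?B) / 2"
    by (intro divide_right_mono add_mono exponential_moment_top W w j j') simp
  finally show ?thesis by simp
qed

text \<open>Markov's inequality for the exponential moment, in unnormalised form.\<close>

lemma diam_tail:
  assumes W: "1 \<le> W" and w: "uncrossing_weight W n w" and j: "j \<in> sym_box n"
    and refl: "\<And>\<pi>. \<pi> \<in> box_perms n \<Longrightarrow> w (reflect \<pi>) = w \<pi>"
  shows "(\<Sum>\<pi>\<in>{\<pi>\<in>box_perms n. L \<le> real_of_int (cycle_diam \<pi> j)}. w \<pi>)
    \<le> 2 * exp (- (decay W / 2 * L)) * sum w (box_perms n)"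
proof -
  let ?c = "decay W / 2"
  let ?A = "{\<pi>\<in>box_perms n. L \<le> real_of_int (cycle_diam \<pi> j)}"
  have w0: "0 \<le> w \<pi>" for \<pi> using w by (simp add: uncrossing_weight_def)
  have c: "0 < ?c" using W by (simp add: decay_def)
  have "exp (?c * L) * sum w ?A = (\<Sum>\<pi>\<in>?A. w \<pi> * exp (?c * L))"
    by (simp add: sum_distrib_left mult.commute)
  also have "\<dots> \<le> (\<Sum>\<pi>\<in>?A. w \<pi> * exp (?c * real_of_int (cycle_diam \<pi> j)))"
    using w0 c by (intro sum_mono mult_left_mono) auto
  also have "\<dots> \<le> (\<Sum>\<pi>\<in>box_perms n. w \<pi> * exp (?c * real_of_int (cycle_diam \<pi> j)))"
    using w0 by (intro sum_mono2) auto
  also have "\<dots> \<le> 2 * sum w (box_perms n)"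
    by (rule exponential_moment_diam[OF assms])
  finally show ?thesis by (simp add: exp_minus field_simps)
qed

section \<open>The Gibbs weights and the band indicator\<close>

lemma uncrossing_weight_finite:
  assumes p: "1 \<le> p" and W: "1 \<le> W"
  shows "uncrossing_weight W n (weight p W n)"
  unfolding uncrossing_weight_def
proof (intro conjI allI ballI impI)
  show "0 \<le> weight p W n \<pi>" for \<pi> by (simp add: weight_def)
next
  fix \<pi> i u k
  assume *: "\<pi> \<in> box_perms n" "i \<in> sym_box n" "u \<in> sym_box n" "i \<le> k" "k < u" "k < \<pi> i" "\<pi> u \<le> k"
  define \<sigma> where "\<sigma> = \<pi> \<circ> swap i u"
  define c where "c \<tau> v = real_of_int \<bar>\<tau> v - v\<bar> powr p" for \<tau> v
  define m where "m = real_of_int (min \<bar>i - k\<bar> \<bar>\<pi> u - k\<bar>)"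
  define l where "l = real_of_int (min \<bar>u - k\<bar> \<bar>\<pi> i - k\<bar>)"
  have ne: "i \<noteq> u" using * by auto
  have m0: "0 \<le> m" "0 \<le> l" by (auto simp: m_def l_def)
  \<comment> \<open>Only the costs at \<open>i\<close> and \<open>u\<close> change under the
    exchange.\<close>
  have split: "sum f (sym_box n) = f i + f u + sum f (sym_box n - {i, u})" for f :: "int \<Rightarrow> real"
    using ne * by (subst sum.subset_diff[of "{i, u}"]) (auto simp: algebra_simps)
  have "sum (c \<sigma>) (sym_box n - {i, u}) = sum (c \<pi>) (sym_box n - {i, u})"
    by (intro sum.cong) (auto simp: c_def \<sigma>_def Transposition.transpose_def)
  moreover have "c \<sigma> i + c \<sigma> u + m powr p + l powr p \<le> c \<pi> i + c \<pi> u"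
  proof -
    define x x' y y' where "x = real_of_int (k - i)" and "x' = real_of_int (k - \<pi> u)"
      and "y = real_of_int (u - k)" and "y' = real_of_int (\<pi> i - k)"
    have nn: "0 \<le> x" "0 \<le> x'" "0 \<le> y" "0 \<le> y'"
      using * by (auto simp: x_def x'_def y_def y'_def)
    have "real_of_int \<bar>\<pi> i - i\<bar> = x + y'" "real_of_int \<bar>\<pi> u - u\<bar> = x' + y"
      "real_of_int \<bar>\<sigma> i - i\<bar> = \<bar>x - x'\<bar>" "real_of_int \<bar>\<sigma> u - u\<bar> = \<bar>y - y'\<bar>"
      "m = min x x'" "l = min y y'"
      using * by (auto simp: x_def x'_def y_def y'_def \<sigma>_def m_def l_def)
    then show ?thesis using powr_uncrossing[OF nn p] by (simp add: c_def)
  qed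
  ultimately have "sum (c \<sigma>) (sym_box n) + m powr p + l powr p \<le> sum (c \<pi>) (sym_box n)"
    using split[of "c \<sigma>"] split[of "c \<pi>"] by linarith
  then have "(sum (c \<sigma>) (sym_box n) + m powr p + l powr p) / W powr p \<le> sum (c \<pi>) (sym_box n) / W powr p"
    by (intro divide_right_mono) auto
  \<comment> \<open>This makes the exponent linear in \<open>m / W\<close> and \<open>l / W\<close>,
    uniformly in \<open>p\<close>; the two losses of 1 become \<open>exp 2\<close>.\<close>
  moreover have "m / W - 1 \<le> m powr p / W powr p" "l / W - 1 \<le> l powr p / W powr p"
    using powr_ge_diff_one[of "m / W" p] powr_ge_diff_one[of "l / W" p] m0 W p
    by (auto simp: powr_divide)
  ultimately have "- (sum (c \<pi>) (sym_box n) / W powr p)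
      \<le> 2 + - m / W + - l / W + - (sum (c \<sigma>) (sym_box n) / W powr p)"
    by (simp add: add_divide_distrib)
  then have "exp (- (sum (c \<pi>) (sym_box n) / W powr p))
      \<le> exp (2 + - m / W + - l / W + - (sum (c \<sigma>) (sym_box n) / W powr p))"
    by simp
  then have "weight p W n \<pi> \<le> exp 2 * exp (- m / W) * exp (- l / W) * weight p W n \<sigma>"
    unfolding exp_add weight_def c_def by simp
  then show "weight p W n \<pi> \<le> exp 2 * exp (- real_of_int (min \<bar>i - k\<bar> \<bar>\<pi> u - k\<bar>) / W)
      * exp (- real_of_int (min \<bar>u - k\<bar> \<bar>\<pi> i - k\<bar>) / W) * weight p W n (\<pi> \<circ> swap i u)"
    by (simp only: m_def l_def \<sigma>_def)
qed

lemma weight_reflect: "weight p W n (reflect \<pi>) = weight p W n \<pi>"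
proof -
  have "bij_betw uminus (sym_box n) (sym_box n)"
    by (rule bij_betwI[where g = uminus]) (auto simp: sym_box_def)
  from sum.reindex_bij_betw[OF this, of "\<lambda>i. real_of_int \<bar>\<pi> i - i\<bar> powr p"]
  have "(\<Sum>i\<in>sym_box n. real_of_int \<bar>\<pi> (- i) + i\<bar> powr p) = (\<Sum>i\<in>sym_box n. real_of_int \<bar>\<pi> i - i\<bar> powr p)"
    by simp
  moreover have "\<bar>reflect \<pi> i - i\<bar> = \<bar>\<pi> (- i) + i\<bar>" for i
    by (simp add: reflect_def)
  ultimately show ?thesis by (simp add: weight_def)
qed

lemma band_perms_iff:
  "\<pi> \<in> band_perms W n \<longleftrightarrow> \<pi> \<in> box_perms n \<and> (\<forall>i\<in>sym_box n. real_of_int \<bar>\<pi> i - i\<bar> \<le> W)"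
proof -
  have "sym_box n \<noteq> {}" by (simp add: sym_box_def)
  then have "real_of_int (Max ((\<lambda>i. \<bar>\<pi> i - i\<bar>) ` sym_box n)) \<le> W
      \<longleftrightarrow> (\<forall>i\<in>sym_box n. real_of_int \<bar>\<pi> i - i\<bar> \<le> W)"
    \<comment> \<open>The floor of \<open>W\<close> moves the comparison to the integers, where
      \<open>Max_le_iff\<close> applies.\<close>
    unfolding le_floor_iff[symmetric] by (subst Max_le_iff) auto
  then show ?thesis by (simp add: band_perms_def)
qed

text \<open>Uncrossing does not increase the larger of the two displacements, so it preserves the
  band. Inside the band \<open>m\<close> and \<open>l\<close> are at most \<open>W\<close>, so
  \<open>exp 2\<close> outweighs both decay factors.\<close>

lemma uncrossing_weight_band:
  assumes W: "1 \<le> W"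
  shows "uncrossing_weight W n (indicator (band_perms W n))"
  unfolding uncrossing_weight_def
proof (intro conjI allI ballI impI)
  fix \<pi> i u k
  assume *: "\<pi> \<in> box_perms n" "i \<in> sym_box n" "u \<in> sym_box n" "i \<le> k" "k < u" "k < \<pi> i" "\<pi> u \<le> k"
  define \<sigma> where "\<sigma> = \<pi> \<circ> swap i u"
  define m where "m = real_of_int (min \<bar>i - k\<bar> \<bar>\<pi> u - k\<bar>)"
  define l where "l = real_of_int (min \<bar>u - k\<bar> \<bar>\<pi> i - k\<bar>)"
  have "indicator (band_perms W n) \<pi>
      \<le> exp 2 * exp (- m / W) * exp (- l / W) * indicator (band_perms W n) \<sigma>"
  proof (cases "\<pi> \<in> band_perms W n")
    case True
    then have le: "real_of_int \<bar>\<pi> v - v\<bar> \<le> W" if "v \<in> sym_box n" for v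
      using that by (auto simp: band_perms_iff)
    have "m \<le> real_of_int \<bar>\<pi> i - i\<bar>" "l \<le> real_of_int \<bar>\<pi> i - i\<bar>"
      unfolding m_def l_def of_int_le_iff using * by auto
    then have ml: "m \<le> W" "l \<le> W" using le[OF *(2)] by auto
    have "\<bar>\<sigma> i - i\<bar> \<le> max \<bar>\<pi> i - i\<bar> \<bar>\<pi> u - u\<bar>" "\<bar>\<sigma> u - u\<bar> \<le> max \<bar>\<pi> i - i\<bar> \<bar>\<pi> u - u\<bar>"
      using * by (auto simp: \<sigma>_def)
    then have "real_of_int \<bar>\<sigma> i - i\<bar> \<le> max (real_of_int \<bar>\<pi> i - i\<bar>) (real_of_int \<bar>\<pi> u - u\<bar>)"
      "real_of_int \<bar>\<sigma> u - u\<bar> \<le> max (real_of_int \<bar>\<pi> i - i\<bar>) (real_of_int \<bar>\<pi> u - u\<bar>)"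
      unfolding of_int_max[symmetric] of_int_le_iff by auto
    then have iu: "real_of_int \<bar>\<sigma> i - i\<bar> \<le> W" "real_of_int \<bar>\<sigma> u - u\<bar> \<le> W"
      using le[OF *(2)] le[OF *(3)] by linarith+
    have "real_of_int \<bar>\<sigma> v - v\<bar> \<le> W" if "v \<in> sym_box n" for v
    proof (cases "v = i \<or> v = u")
      case False
      then have "\<sigma> v = \<pi> v" by (simp add: \<sigma>_def Transposition.transpose_def)
      then show ?thesis using le[OF that] by simp
    qed (use iu in auto)
    moreover have "\<sigma> \<in> box_perms n"
      using * by (auto simp: \<sigma>_def box_perms_def intro!: permutes_compose permutes_swap_id)
    ultimately have "\<sigma> \<in> band_perms W n" by (simp add: band_perms_iff)
    moreover have "m / W \<le> 1" "l / W \<le> 1" using ml W by auto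
    then have "1 \<le> exp (2 + - m / W + - l / W)" by simp
    ultimately show ?thesis using True unfolding exp_add by simp
  qed simp
  then show "indicator (band_perms W n) \<pi> \<le> exp 2 * exp (- real_of_int (min \<bar>i - k\<bar> \<bar>\<pi> u - k\<bar>) / W)
      * exp (- real_of_int (min \<bar>u - k\<bar> \<bar>\<pi> i - k\<bar>) / W) * indicator (band_perms W n) (\<pi> \<circ> swap i u)"
    by (simp only: m_def l_def \<sigma>_def)
qed simp

lemma reflect_band_perms:
  assumes "\<pi> \<in> box_perms n"
  shows "reflect \<pi> \<in> band_perms W n \<longleftrightarrow> \<pi> \<in> band_perms W n"
proof -
  have "reflect \<tau> \<in> band_perms W n" if "\<tau> \<in> band_perms W n" for \<tau>
  proof -
    have "real_of_int \<bar>reflect \<tau> i - i\<bar> \<le> W" if "i \<in> sym_box n" for i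
    proof -
      have "- i \<in> sym_box n" using that by (auto simp: sym_box_def)
      moreover have "\<bar>reflect \<tau> i - i\<bar> = \<bar>\<tau> (- i) - (- i)\<bar>" by (simp add: reflect_def)
      ultimately show ?thesis using \<open>\<tau> \<in> band_perms W n\<close> by (metis band_perms_iff)
    qed
    then show ?thesis using that by (simp add: band_perms_iff reflect_box_perms)
  qed
  then show ?thesis by (metis reflect_reflect)
qed

section \<open>From weights to probabilities\<close>

lemma prob_perm_pmf_finite:
  assumes "p \<noteq> \<infinity>"
  shows "measure_pmf.prob (perm_pmf p W n) A
    = sum (weight (real_of_ereal p) W n) (box_perms n \<inter> A) / partition_fun (real_of_ereal p) W n"
proof -
  have "measure_pmf.prob (perm_pmf p W n) A = measure_pmf.prob (perm_pmf p W n) (box_perms n \<inter> A)"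
    by (intro measure_pmf.finite_measure_eq_AE)
       (auto simp: AE_measure_pmf_iff set_pmf_iff pmf_perm_pmf_finite[OF assms] split: if_splits)
  also have "\<dots> = (\<Sum>\<pi>\<in>box_perms n \<inter> A. pmf (perm_pmf p W n) \<pi>)"
    by (rule measure_measure_pmf_finite) simp
  also have "\<dots> = (\<Sum>\<pi>\<in>box_perms n \<inter> A.
      weight (real_of_ereal p) W n \<pi> / partition_fun (real_of_ereal p) W n)"
    by (intro sum.cong) (auto simp: pmf_perm_pmf_finite[OF assms])
  finally show ?thesis by (simp add: sum_divide_distrib)
qed

theorem theorem1:
  shows "\<exists>c::real. c > 0 \<and>
    (\<forall>(p::ereal) (n::nat) (W::real) (L::real) (j::int).
       1 \<le> p \<longrightarrow> 1 \<le> n \<longrightarrow> 1 \<le> W \<longrightarrow> 1 \<le> L \<longrightarrow> j \<in> {- int n..int n} \<longrightarrow>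
       measure_pmf.prob (perm_pmf p W n) {\<pi>. L \<le> real_of_int (cycle_diam \<pi> j)}
         \<le> 2 * exp (- c * (L / W ^ 3)))"
\<comment> \<open>\<open>46080 = 2 * 23040\<close>, since the diameter decays at half the rate
  \<open>decay W\<close>.\<close>
proof (intro exI[of _ "1 / 46080"] conjI allI impI)
  fix p :: ereal and n :: nat and W L :: real and j :: int
  assume p: "1 \<le> p" and W: "1 \<le> W" and "j \<in> {- int n..int n}"
  then have j: "j \<in> sym_box n" by (simp add: sym_box_def)
  let ?A = "{\<pi>. L \<le> real_of_int (cycle_diam \<pi> j)}"
  have rate: "- (decay W / 2 * L) = - (1 / 46080) * (L / W ^ 3)"
    by (simp add: decay_def)
  have A: "box_perms n \<inter> ?A = {\<pi>\<in>box_perms n. L \<le> real_of_int (cycle_diam \<pi> j)}" by auto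
  show "measure_pmf.prob (perm_pmf p W n) ?A \<le> 2 * exp (- (1 / 46080) * (L / W ^ 3))"
  proof (cases "p = \<infinity>")
    case False
    with p have r: "1 \<le> real_of_ereal p" by (cases p) auto
    have "sum (weight (real_of_ereal p) W n) (box_perms n \<inter> ?A)
        \<le> 2 * exp (- (decay W / 2 * L)) * partition_fun (real_of_ereal p) W n"
      unfolding A partition_fun_def
      by (rule diam_tail[OF W uncrossing_weight_finite[OF r W] j weight_reflect])
    then show ?thesis
      unfolding prob_perm_pmf_finite[OF False] rate
      using partition_fun_pos[of "real_of_ereal p" W n] by (simp add: divide_le_eq)
  next
    case True
    let ?w = "indicator (band_perms W n) :: (int \<Rightarrow> int) \<Rightarrow> real"
    have ne: "band_perms W n \<noteq> {}" using W by (intro band_perms_nonempty) auto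
    have card: "sum ?w B = real (card (band_perms W n \<inter> B))" if "finite B" for B
      using that by (simp add: indicator_def sum.If_cases Int_def conj_commute)
    have sub: "band_perms W n \<subseteq> box_perms n" by (auto simp: band_perms_def)
    have "sum ?w (box_perms n \<inter> ?A) \<le> 2 * exp (- (decay W / 2 * L)) * sum ?w (box_perms n)"
      unfolding A
      by (rule diam_tail[OF W uncrossing_weight_band[OF W] j])
         (simp add: indicator_def reflect_band_perms)
    moreover have "band_perms W n \<inter> (box_perms n \<inter> ?A) = band_perms W n \<inter> ?A"
      "band_perms W n \<inter> box_perms n = band_perms W n" using sub by auto
    ultimately have "real (card (band_perms W n \<inter> ?A))
        \<le> 2 * exp (- (decay W / 2 * L)) * real (card (band_perms W n))"
      by (simp add: card)
    moreover have "0 < card (band_perms W n)" using ne by (simp add: card_gt_0_iff)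
    ultimately show ?thesis
      unfolding True perm_pmf_def rate by (simp add: measure_pmf_of_set ne divide_le_eq)
  qed
qed simp

end
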